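(* There exists a crowded Tychonoff space $X$ that is $C_2$-tight but not $\omega\mathrm{N}$-tight, and hence not $\omega\mathrm{D}$-tight either.
   Context: For a property $\mathcal{P}$ that a subspace of a topological space may have, a space $X$ is called $\mathcal{P}$-tight if for all $x\in X$ and $A\subseteq X$ with $x\in\overline{A}$ there is $B\subseteq A$ such that $x\in\overline{B}$ and $B$ has property $\mathcal{P}$. The properties used are: $C_2$: $B$ is second-countable in the subspace topology; $\omega\mathrm{N}$: $B$ is countable and nowhere dense in $X$; $\omega\mathrm{D}$: $B$ is countable and discrete in the subspace topology. A space is crowded if it has no isolated points. *)

theory Defs
  imports "HOL-Analysis.Analysis"
begin

(* Spaces are elements of 'a topology, with points the elements of topspace X.
   HOL cannot quantify existentially over types, so an existence claim about spaces has to fix a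
   type that contains the points.  For the existence theorem this is "real set": topspace X may be
   any subset of it, so every topological space of cardinality at most 2^(2^aleph_0), in particular
   every separable Hausdorff space, occurs up to homeomorphism. *)

definition property_tight :: "('a topology \<Rightarrow> 'a set \<Rightarrow> bool) \<Rightarrow> 'a topology \<Rightarrow> bool" where
  "property_tight P X \<longleftrightarrow>
     (\<forall>x A. x \<in> topspace X \<and> A \<subseteq> topspace X \<and> x \<in> X closure_of A \<longrightarrow>
        (\<exists>B. B \<subseteq> A \<and> x \<in> X closure_of B \<and> P X B))"

definition nowhere_dense_in :: "'a topology \<Rightarrow> 'a set \<Rightarrow> bool" where
  "nowhere_dense_in X B \<longleftrightarrow> X interior_of (X closure_of B) = {}"

definition prop_C2 :: "'a topology \<Rightarrow> 'a set \<Rightarrow> bool" where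
  "prop_C2 X B \<longleftrightarrow> second_countable (subtopology X B)"

definition prop_omega_N :: "'a topology \<Rightarrow> 'a set \<Rightarrow> bool" where
  "prop_omega_N X B \<longleftrightarrow> countable B \<and> nowhere_dense_in X B"

definition prop_omega_D :: "'a topology \<Rightarrow> 'a set \<Rightarrow> bool" where
  "prop_omega_D X B \<longleftrightarrow> countable B \<and> subtopology X B = discrete_topology B"

definition crowded_space :: "'a topology \<Rightarrow> bool" where
  "crowded_space X \<longleftrightarrow> (\<forall>x \<in> topspace X. \<not> openin X {x})"

definition tychonoff_space :: "'a topology \<Rightarrow> bool" where
  "tychonoff_space X \<longleftrightarrow> completely_regular_space X \<and> t1_space X"

end

theory Submission
  imports Defs
begin

text \<open>
  Take a second countable, crowded, zero-dimensional space \<open>Y\<close> that splits into infinitely many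
  clopen pieces, and adjoin a point \<open>p\<close> that is remote in the sense of van Douwen: every nowhere
  dense subset of \<open>Y\<close> misses a neighbourhood of \<open>p\<close>. Then \<open>p\<close> is in the closure of \<open>Y\<close> but not of any
  nowhere dense subset of \<open>Y\<close>, while every set disjoint from \<open>{p}\<close> is second countable.

  To make \<open>p\<close> non-isolated, one assigns to every nowhere dense \<open>D\<close> a clopen set \<open>F D\<close> missing \<open>D\<close>
  such that finitely many of these sets always meet. In the \<open>n\<close>-th piece, with a countable clopen
  \<open>\<pi>\<close>-base \<open>B\<close>, let \<open>k i\<close> be an index with \<open>B (k i) \<subseteq> B i - D\<close>. The trace of \<open>F D\<close> is the finite union
  of the \<open>B (k i)\<close> with \<open>i\<close> up to a bound obtained by iterating \<open>k\<close> so often (\<open>n\<close> times) that any \<open>n\<close>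
  traces have a common point. A family of \<open>m\<close> sets \<open>F D\<close> then meets in the \<open>m\<close>-th piece.
\<close>

section \<open>Linked unions of refinements\<close>

text \<open>Inserting the previous value keeps the bounds monotone in \<open>l\<close> even where
  \<open>k\<close> lowers indices; the maximum over the image makes \<open>k\<close> send indices
  within level \<open>l\<close> to indices within level \<open>Suc l\<close>.\<close>

primrec reach :: "(nat \<Rightarrow> nat) \<Rightarrow> nat \<Rightarrow> nat" where
  "reach k 0 = 0"
| "reach k (Suc l) = Max (insert (reach k l) (k ` {..reach k l}))"

lemma reach_mono: "l \<le> l' \<Longrightarrow> reach k l \<le> reach k l'"
  by (rule lift_Suc_mono_le[where f = "reach k"]) auto

lemma refinement_le_reach: "i \<le> reach k l \<Longrightarrow> k i \<le> reach k (Suc l)"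
  using Max_ge[of "insert (reach k l) (k ` {..reach k l})" "k i"] by simp

definition refinement_union :: "(nat \<Rightarrow> 'a set) \<Rightarrow> (nat \<Rightarrow> nat) \<Rightarrow> nat \<Rightarrow> 'a set" where
  "refinement_union B k l = (\<Union>i\<le>reach k l. B (k i))"

lemma refinement_union_mono: "l \<le> l' \<Longrightarrow> refinement_union B k l \<subseteq> refinement_union B k l'"
  unfolding refinement_union_def using reach_mono[of l l' k] by (meson UN_mono atMost_subset_iff order_refl)

text \<open>Greedy descent: serving one \<open>d\<close> replaces the current index
  \<open>i0\<close> by \<open>k d i0\<close> and costs one level, so \<open>card S\<close> extra
  levels suffice. Index and level are arbitrary because the induction resumes from
  \<open>k d i0\<close> at level \<open>Suc l\<close>.\<close>

lemma refinement_unions_linked: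
  assumes "finite S"
    and "\<And>d i. d \<in> S \<Longrightarrow> B (k d i) \<subseteq> B i"
    and "\<And>d. d \<in> S \<Longrightarrow> i0 \<le> reach (k d) l"
  shows "\<exists>i. B i \<subseteq> B i0 \<and> (\<forall>d\<in>S. B i \<subseteq> refinement_union B (k d) (l + card S))"
  using assms
proof (induction "card S" arbitrary: S i0 l)
  case 0
  then show ?case by auto
next
  case (Suc n)
  then have "S \<noteq> {}" by auto
  \<comment> \<open>Serving first the index that reaches least far keeps the refinement within reach of all others.\<close>
  then obtain d where d: "d \<in> S" "\<And>e. e \<in> S \<Longrightarrow> reach (k d) (Suc l) \<le> reach (k e) (Suc l)"
    using arg_min_if_finite[OF \<open>finite S\<close>, of "\<lambda>d. reach (k d) (Suc l)"] not_le by metis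
  let ?i1 = "k d i0"
  have step: "?i1 \<le> reach (k e) (Suc l)" if "e \<in> S" for e
    using refinement_le_reach[OF Suc.prems(3)[OF d(1)]] d(2)[OF that] by linarith
  have card: "n = card (S - {d})" "Suc l + card (S - {d}) = l + card S"
    using d(1) Suc.prems(1) Suc.hyps(2) by auto
  obtain i where i: "B i \<subseteq> B ?i1"
    "\<And>e. e \<in> S - {d} \<Longrightarrow> B i \<subseteq> refinement_union B (k e) (l + card S)"
    using Suc.hyps(1)[OF card(1), of ?i1 "Suc l"] Suc.prems step unfolding card(2) by auto
  \<comment> \<open>The chosen \<open>d\<close> is served at once: \<open>i0\<close> is within its
    reach at level \<open>l\<close>, so \<open>B (k d i0)\<close> is one of the sets united.\<close>
  have "B ?i1 \<subseteq> refinement_union B (k d) l"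
    unfolding refinement_union_def using Suc.prems(3)[OF d(1)] by auto
  then have "B i \<subseteq> refinement_union B (k d) (l + card S)"
    using i(1) refinement_union_mono[of l "l + card S" B "k d"] by auto
  then show ?case
    using i Suc.prems(2)[OF d(1), of i0] by (metis DiffI empty_iff insert_iff order_trans)
qed

section \<open>Clopen families avoiding the nowhere dense sets\<close>

definition clopenin :: "'a topology \<Rightarrow> 'a set \<Rightarrow> bool" where
  "clopenin X C \<longleftrightarrow> openin X C \<and> closedin X C"

text \<open>This is zero-dimensionality, the property through which complete regularity is carried
  over to the extension.\<close>

definition clopen_based :: "'a topology \<Rightarrow> bool" where
  "clopen_based X \<longleftrightarrow>
     (\<forall>W x. openin X W \<and> x \<in> W \<longrightarrow> (\<exists>C. clopenin X C \<and> x \<in> C \<and> C \<subseteq> W))"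

text \<open>The characteristic function of the complement of a clopen neighbourhood separates the
  point from the closed set.\<close>

lemma clopen_based_imp_completely_regular:
  assumes "clopen_based X"
  shows "completely_regular_space X"
  unfolding completely_regular_space_def
proof (intro allI impI, elim conjE)
  fix S x
  assume S: "closedin X S" "x \<in> topspace X - S"
  then obtain C where C: "openin X C" "closedin X C" "x \<in> C" "C \<subseteq> topspace X - S"
    using assms unfolding clopen_based_def clopenin_def by (metis openin_diff openin_topspace)
  let ?f = "\<lambda>y. if y \<in> C then 0 else 1 :: real"
  have "openin X {y \<in> topspace X. ?f y \<in> V}" for V
  proof -
    have "{y \<in> topspace X. ?f y \<in> V} =
        (if 0 \<in> V then C else {}) \<union> (if 1 \<in> V then topspace X - C else {})"
      using openin_subset[OF C(1)] by auto
    then show ?thesis using C by auto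
  qed
  then have "continuous_map X (top_of_set {0..1}) ?f"
    by (auto simp: continuous_map_in_subtopology continuous_map_def)
  then show "\<exists>f. continuous_map X (top_of_set {0..1::real}) f \<and> f x = 0 \<and> f ` S \<subseteq> {1}"
    using C by (intro exI[of _ ?f]) auto
qed

text \<open>The first clause will make the new point remote, the second non-isolated. The factor
  \<open>topspace Y\<close> gives the empty family the whole space instead of
  \<open>UNIV\<close>.\<close>

definition remote_family :: "'a topology \<Rightarrow> ('a set \<Rightarrow> 'a set) \<Rightarrow> bool" where
  "remote_family Y F \<longleftrightarrow>
     (\<forall>D. nowhere_dense_in Y D \<longrightarrow> clopenin Y (F D) \<and> F D \<inter> D = {}) \<and>
     (\<forall>S. finite S \<and> (\<forall>D\<in>S. nowhere_dense_in Y D) \<longrightarrow> topspace Y \<inter> \<Inter>(F ` S) \<noteq> {})"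

text \<open>Keep the nonempty members of a countable base that lie in \<open>U\<close>, and shrink
  each to a nonempty clopen set. The result is only a \<pi>-base of \<open>U\<close>, which is
  enough for finding refinements off a nowhere dense set.\<close>

lemma countable_clopen_pi_base:
  assumes "second_countable Y" "clopen_based Y" "openin Y U" "U \<noteq> {}"
  obtains B :: "nat \<Rightarrow> 'a set"
  where "\<And>i. clopenin Y (B i)" "\<And>i. B i \<noteq> {}" "\<And>i. B i \<subseteq> U"
    "\<And>W. openin Y W \<Longrightarrow> W \<subseteq> U \<Longrightarrow> W \<noteq> {} \<Longrightarrow> \<exists>i. B i \<subseteq> W"
proof -
  obtain \<B> where base: "countable \<B> \<and> (\<forall>V\<in>\<B>. openin Y V) \<and>
      (\<forall>W x. openin Y W \<and> x \<in> W \<longrightarrow> (\<exists>V\<in>\<B>. x \<in> V \<and> V \<subseteq> W))"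
    using assms(1) unfolding second_countable_def by (elim exE)
  then have \<B>: "countable \<B>" "\<And>V. V \<in> \<B> \<Longrightarrow> openin Y V" by auto
  define \<V> where "\<V> = {V \<in> \<B>. V \<noteq> {} \<and> V \<subseteq> U}"
  have "\<exists>C. clopenin Y C \<and> C \<noteq> {} \<and> C \<subseteq> V" if V: "V \<in> \<V>" for V
  proof -
    obtain x where "x \<in> V" "openin Y V" using V \<B>(2) unfolding \<V>_def by auto
    then show ?thesis using assms(2) unfolding clopen_based_def by blast
  qed
  then obtain c where c: "\<And>V. V \<in> \<V> \<Longrightarrow> clopenin Y (c V) \<and> c V \<noteq> {} \<and> c V \<subseteq> V"
    by metis
  have dense: "\<exists>V\<in>\<V>. V \<subseteq> W" if "openin Y W" "W \<subseteq> U" "W \<noteq> {}" for W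
  proof -
    obtain x where "x \<in> W" using \<open>W \<noteq> {}\<close> by blast
    then obtain V where "V \<in> \<B>" "x \<in> V" "V \<subseteq> W" using base \<open>openin Y W\<close> by meson
    then show ?thesis using \<open>W \<subseteq> U\<close> unfolding \<V>_def by blast
  qed
  \<comment> \<open>Nonemptiness, obtained from \<open>U\<close> itself, is what lets
    \<open>from_nat_into\<close> enumerate exactly \<V>, possibly with repetitions.\<close>
  have "\<V> \<noteq> {}" "countable \<V>"
    using dense[of U] assms(3,4) \<B>(1) by (auto simp: \<V>_def)
  then have V: "range (from_nat_into \<V>) = \<V>"
    by (rule range_from_nat_into)
  show thesis
  proof (rule that[of "\<lambda>i. c (from_nat_into \<V> i)"])
    fix i
    have *: "from_nat_into \<V> i \<in> \<V>" using V by auto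
    from c[OF *] show "clopenin Y (c (from_nat_into \<V> i))" "c (from_nat_into \<V> i) \<noteq> {}" by auto
    from c[OF *] * show "c (from_nat_into \<V> i) \<subseteq> U" unfolding \<V>_def by auto
  next
    fix W assume "openin Y W" "W \<subseteq> U" "W \<noteq> {}"
    then obtain V where "V \<in> \<V>" "V \<subseteq> W" using dense by blast
    moreover then obtain i where "V = from_nat_into \<V> i" using V by blast
    ultimately show "\<exists>i. c (from_nat_into \<V> i) \<subseteq> W" using c by (metis order_trans)
  qed
qed

text \<open>Infinitely many closed sets have a closed union here because the complement splits along
  the pieces into the open sets \<open>U n - C n\<close>.\<close>

lemma clopenin_disjoint_union:
  assumes U: "\<And>n. openin Y (U n)" "disjoint_family U" "(\<Union>n. U n) = topspace Y"
    and C: "\<And>n. clopenin Y (C n)" "\<And>n. C n \<subseteq> U n"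
  shows "clopenin Y (\<Union>n. C n)"
proof -
  have "topspace Y - (\<Union>n. C n) = (\<Union>n. U n - C n)"
  proof (rule set_eqI)
    fix x
    have "x \<notin> C m" if "x \<in> U n - C n" for m n
      using that U(2) C(2)[of m] unfolding disjoint_family_on_def by (cases "m = n") auto
    then show "x \<in> topspace Y - (\<Union>n. C n) \<longleftrightarrow> x \<in> (\<Union>n. U n - C n)"
      unfolding U(3)[symmetric] by fast
  qed
  moreover have "openin Y (U n - C n)" for n
    using U(1) C(1) unfolding clopenin_def by (simp add: openin_diff)
  ultimately show ?thesis
    using C(1) openin_subset unfolding clopenin_def closedin_def by (force intro!: openin_Union)
qed

lemma clopenin_refinement_union:
  assumes "\<And>i. clopenin Y (B i)"
  shows "clopenin Y (refinement_union B k l)"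
  using assms unfolding clopenin_def refinement_union_def
  by (auto intro!: closedin_Union openin_Union)

lemma exists_remote_family:
  fixes Y :: "'a topology"
  assumes Y: "second_countable Y" "clopen_based Y"
    and U: "\<And>n :: nat. openin Y (U n)" "\<And>n. U n \<noteq> {}" "disjoint_family U" "(\<Union>n. U n) = topspace Y"
  obtains F where "remote_family Y F"
proof -
  have "\<exists>B :: nat \<Rightarrow> 'a set. (\<forall>i. clopenin Y (B i)) \<and> (\<forall>i. B i \<noteq> {}) \<and> (\<forall>i. B i \<subseteq> U n) \<and>
    (\<forall>W. openin Y W \<longrightarrow> W \<subseteq> U n \<longrightarrow> W \<noteq> {} \<longrightarrow> (\<exists>i. B i \<subseteq> W))" for n
    using countable_clopen_pi_base[OF Y U(1,2)[of n]] by metis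
  then obtain B :: "nat \<Rightarrow> nat \<Rightarrow> 'a set" where
    B: "\<And>n i. clopenin Y (B n i)" "\<And>n i. B n i \<noteq> {}" "\<And>n i. B n i \<subseteq> U n"
       "\<And>n W. openin Y W \<Longrightarrow> W \<subseteq> U n \<Longrightarrow> W \<noteq> {} \<Longrightarrow> \<exists>i. B n i \<subseteq> W"
    by metis
  define k where "k n D i = (SOME j. B n j \<subseteq> B n i - D)" for n D i
  have ex: "\<exists>j. B n j \<subseteq> B n i - D" if "nowhere_dense_in Y D" for D n i
  proof -
    have op: "openin Y (B n i)" using B(1) by (auto simp: clopenin_def)
    \<comment> \<open>Otherwise the nonempty open set \<open>B n i\<close> would lie in the interior
      of the closure of \<open>D\<close>. Removing the closure instead of \<open>D\<close> leaves an
      open set, to which the \<pi>-base applies.\<close>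
    have "\<not> B n i \<subseteq> Y closure_of D"
      using that B(2) interior_of_maximal[OF _ op] unfolding nowhere_dense_in_def by blast
    then obtain j where "B n j \<subseteq> B n i - Y closure_of D"
      using B(4)[of "B n i - Y closure_of D" n] B(3)[of n i] op by (auto simp: openin_diff)
    \<comment> \<open>\<open>D\<close> may have points outside the space, which its closure does not
      contain; \<open>B n j\<close> avoids them by lying in the space.\<close>
    moreover have "B n j \<subseteq> topspace Y" using B(3) U(4) by blast
    moreover have "topspace Y \<inter> D \<subseteq> Y closure_of D" by (rule closure_of_subset_Int)
    ultimately show ?thesis by blast
  qed
  have k: "B n (k n D i) \<subseteq> B n i - D" if "nowhere_dense_in Y D" for D n i
    unfolding k_def using ex[OF that] by (rule someI_ex)
  define F where "F D = (\<Union>n. refinement_union (B n) (k n D) n)" for D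
  have sub: "refinement_union (B n) (k n D) n \<subseteq> U n" for n D
    unfolding refinement_union_def using B(3) by blast
  have "clopenin Y (F D)" for D
    unfolding F_def using U(1,3,4) clopenin_refinement_union[OF B(1)] sub
    by (rule clopenin_disjoint_union)
  moreover have "F D \<inter> D = {}" if "nowhere_dense_in Y D" for D
    using k[OF that] unfolding F_def refinement_union_def by blast
  moreover have "topspace Y \<inter> \<Inter>(F ` S) \<noteq> {}"
    if S: "finite S" "\<forall>D\<in>S. nowhere_dense_in Y D" for S
  proof -
    \<comment> \<open>In the piece with index \<open>card S\<close> the traces have level
      \<open>card S\<close>, exactly what a descent from index 0 at level 0 requires.\<close>
    let ?n = "card S"
    obtain i where i: "\<forall>D\<in>S. B ?n i \<subseteq> refinement_union (B ?n) (k ?n D) (0 + ?n)"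
      using refinement_unions_linked[OF S(1), of "B ?n" "k ?n" 0 0] k S(2) by fastforce
    then have "B ?n i \<subseteq> topspace Y \<inter> \<Inter>(F ` S)"
      using B(3)[of ?n i] U(4)[symmetric] unfolding F_def by auto
    then show ?thesis using B(2)[of ?n i] by blast
  qed
  ultimately have "remote_family Y F" unfolding remote_family_def by simp
  then show thesis by (rule that)
qed

section \<open>Adjoining a remote point\<close>

text \<open>The sets \<open>insert p (\<Inter>(F ` S))\<close>, for finite families \<open>S\<close> of nowhere dense sets, form a
  neighbourhood base at the new point \<open>p\<close>.\<close>

definition remote_extension :: "'a topology \<Rightarrow> ('a set \<Rightarrow> 'a set) \<Rightarrow> 'a \<Rightarrow> 'a topology" where
  "remote_extension Y F p = topology (\<lambda>W.
     W \<subseteq> insert p (topspace Y) \<and> openin Y (W - {p}) \<and>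
     (p \<in> W \<longrightarrow> (\<exists>S. finite S \<and> (\<forall>D\<in>S. nowhere_dense_in Y D) \<and> topspace Y \<inter> \<Inter>(F ` S) \<subseteq> W)))"

text \<open>Neighbourhoods of \<open>p\<close> are stable under intersection because two witnessing
  families can be united.\<close>

lemma openin_remote_extension:
  "openin (remote_extension Y F p) W \<longleftrightarrow>
     W \<subseteq> insert p (topspace Y) \<and> openin Y (W - {p}) \<and>
     (p \<in> W \<longrightarrow> (\<exists>S. finite S \<and> (\<forall>D\<in>S. nowhere_dense_in Y D) \<and> topspace Y \<inter> \<Inter>(F ` S) \<subseteq> W))"
  (is "_ = ?L W")
proof -
  have inter: "?L (V \<inter> W)" if V: "?L V" and W: "?L W" for V W
  proof -
    have "openin Y ((V - {p}) \<inter> (W - {p}))" using V W by blast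
    moreover have "(V - {p}) \<inter> (W - {p}) = V \<inter> W - {p}" by blast
    moreover have "\<exists>S. finite S \<and> (\<forall>D\<in>S. nowhere_dense_in Y D) \<and> topspace Y \<inter> \<Inter>(F ` S) \<subseteq> V \<inter> W"
      if p: "p \<in> V \<inter> W"
    proof -
      obtain S where S: "finite S" "\<forall>D\<in>S. nowhere_dense_in Y D" "topspace Y \<inter> \<Inter>(F ` S) \<subseteq> V"
        using V p by auto
      obtain T where T: "finite T" "\<forall>D\<in>T. nowhere_dense_in Y D" "topspace Y \<inter> \<Inter>(F ` T) \<subseteq> W"
        using W p by auto
      show ?thesis using S T by (intro exI[of _ "S \<union> T"]) auto
    qed
    ultimately show ?thesis using V by auto
  qed
  have union: "?L (\<Union>\<K>)" if K: "\<forall>K\<in>\<K>. ?L K" for \<K>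
  proof -
    have "\<Union>\<K> - {p} = (\<Union>K\<in>\<K>. K - {p})" by blast
    moreover have "openin Y (\<Union>K\<in>\<K>. K - {p})" using K by (intro openin_Union) auto
    moreover have "\<exists>S. finite S \<and> (\<forall>D\<in>S. nowhere_dense_in Y D) \<and> topspace Y \<inter> \<Inter>(F ` S) \<subseteq> \<Union>\<K>"
      if "p \<in> \<Union>\<K>"
      using that K by (meson Union_iff Union_upper order_trans)
    ultimately show ?thesis using K by auto
  qed
  have "istopology ?L"
    unfolding istopology_def
    by (rule conjI; intro allI impI) (erule (1) inter, erule union)
  then show ?thesis unfolding remote_extension_def by simp
qed

section \<open>Open and clopen sets of the extension\<close>

context
  fixes Y :: "'a topology" and F :: "'a set \<Rightarrow> 'a set" and p :: 'a
  assumes p: "p \<notin> topspace Y"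
begin

lemma topspace_remote_extension: "topspace (remote_extension Y F p) = insert p (topspace Y)"
proof (rule antisym)
  show "topspace (remote_extension Y F p) \<subseteq> insert p (topspace Y)"
    using openin_topspace[of "remote_extension Y F p"] unfolding openin_remote_extension by blast
  have "insert p (topspace Y) - {p} = topspace Y" using p by auto
  \<comment> \<open>At \<open>p\<close> the empty family is the witness.\<close>
  then have "openin (remote_extension Y F p) (insert p (topspace Y))"
    unfolding openin_remote_extension by (auto intro!: exI[of _ "{}"])
  then show "insert p (topspace Y) \<subseteq> topspace (remote_extension Y F p)"
    by (rule openin_subset)
qed

lemma openin_remote_extension_of_base:
  assumes "openin Y W"
  shows "openin (remote_extension Y F p) W"
proof -
  have "W \<subseteq> topspace Y" using assms by (rule openin_subset)
  moreover then have "W - {p} = W" using p by auto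
  ultimately show ?thesis using assms p unfolding openin_remote_extension by auto
qed

lemma openin_remote_extension_insert:
  assumes "openin Y W" "nowhere_dense_in Y D" "F D \<subseteq> W"
  shows "openin (remote_extension Y F p) (insert p W)"
proof -
  have "W \<subseteq> topspace Y" using assms(1) by (rule openin_subset)
  moreover then have "insert p W - {p} = W" using p by auto
  ultimately show ?thesis
    using assms unfolding openin_remote_extension by (auto intro!: exI[of _ "{D}"])
qed

lemma openin_base_of_remote_extension:
  "openin (remote_extension Y F p) W \<Longrightarrow> openin Y (W \<inter> topspace Y)"
proof -
  assume "openin (remote_extension Y F p) W"
  then have "openin Y (W - {p})" "W \<inter> topspace Y = W - {p}"
    using p unfolding openin_remote_extension by auto
  then show ?thesis by simp
qed

text \<open>The old space is kept as a subspace, so its subsets inherit second countability inside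
  the extension.\<close>

lemma subtopology_remote_extension: "subtopology (remote_extension Y F p) (topspace Y) = Y"
  unfolding topology_eq
proof
  fix S
  show "openin (subtopology (remote_extension Y F p) (topspace Y)) S \<longleftrightarrow> openin Y S"
  proof
    assume "openin (subtopology (remote_extension Y F p) (topspace Y)) S"
    then show "openin Y S"
      unfolding openin_subtopology using openin_base_of_remote_extension by blast
  next
    assume S: "openin Y S"
    then have "S = S \<inter> topspace Y" by (blast dest: openin_subset)
    then show "openin (subtopology (remote_extension Y F p) (topspace Y)) S"
      unfolding openin_subtopology using openin_remote_extension_of_base[OF S] by blast
  qed
qed

text \<open>Since \<open>p\<close> is inside the set, its complement is an open subset of
  \<open>Y\<close> and no condition at \<open>p\<close> arises for it.\<close>

lemma clopenin_remote_extension_insert: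
  assumes "clopenin Y W" "nowhere_dense_in Y D" "F D \<subseteq> W"
  shows "clopenin (remote_extension Y F p) (insert p W)"
proof -
  have "openin Y (topspace Y - W)" using assms(1) unfolding clopenin_def by blast
  moreover have "insert p (topspace Y) - insert p W = topspace Y - W" using p by auto
  moreover have "W \<subseteq> topspace Y" using assms(1) unfolding clopenin_def by (blast dest: openin_subset)
  ultimately show ?thesis
    using assms openin_remote_extension_insert openin_remote_extension_of_base
    unfolding clopenin_def closedin_def topspace_remote_extension by auto
qed

lemma clopenin_remote_extension_compl:
  assumes "clopenin (remote_extension Y F p) C"
  shows "clopenin (remote_extension Y F p) (insert p (topspace Y) - C)"
  using assms unfolding clopenin_def topspace_remote_extension[symmetric]
  by (simp add: openin_diff closedin_diff)

section \<open>Separation, crowdedness and tightness of the extension\<close>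

context
  assumes F: "remote_family Y F" and crowded: "crowded_space Y" and t1: "t1_space Y"
begin

text \<open>This makes the sets \<open>F {y}\<close> available: each gives a clopen neighbourhood of
  \<open>p\<close> that misses \<open>y\<close>.\<close>

lemma nowhere_dense_singleton:
  assumes "y \<in> topspace Y" shows "nowhere_dense_in Y {y}"
proof -
  have "Y closure_of {y} = {y}"
    using t1 assms by (simp add: closure_of_eq t1_space_closedin_singleton)
  moreover have "Y interior_of {y} = {}"
    using crowded assms interior_of_subset[of Y "{y}"] openin_interior_of[of Y "{y}"]
    unfolding crowded_space_def by (metis subset_singletonD)
  ultimately show ?thesis unfolding nowhere_dense_in_def by simp
qed

lemma remote_family_clopen: "nowhere_dense_in Y D \<Longrightarrow> clopenin Y (F D)"
  and remote_family_disjoint: "nowhere_dense_in Y D \<Longrightarrow> F D \<inter> D = {}"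
  using F unfolding remote_family_def by auto

text \<open>The finite intersection property of the family keeps \<open>p\<close> from being
  isolated and puts it in the closure of \<open>Y\<close>.\<close>

lemma remote_nbhd_meets_base:
  assumes "openin (remote_extension Y F p) W" "p \<in> W"
  shows "W \<inter> topspace Y \<noteq> {}"
proof -
  obtain S where S: "finite S" "\<forall>D\<in>S. nowhere_dense_in Y D" "topspace Y \<inter> \<Inter>(F ` S) \<subseteq> W"
    using assms unfolding openin_remote_extension by auto
  have "topspace Y \<inter> \<Inter>(F ` S) \<noteq> {}"
    using F S(1,2) unfolding remote_family_def by simp
  then show ?thesis using S(3) by blast
qed

lemma crowded_remote_extension: "crowded_space (remote_extension Y F p)"
  unfolding crowded_space_def topspace_remote_extension
proof (intro ballI notI)
  fix x assume x: "x \<in> insert p (topspace Y)" "openin (remote_extension Y F p) {x}"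
  show False
  proof (cases "x = p")
    case True
    then show False using remote_nbhd_meets_base[OF x(2)] p by auto
  next
    case False
    then have "openin Y {x}" using openin_base_of_remote_extension[OF x(2)] x(1) by simp
    then show False using crowded x(1) False unfolding crowded_space_def by auto
  qed
qed

lemma t1_remote_extension: "t1_space (remote_extension Y F p)"
  unfolding t1_space_closedin_singleton topspace_remote_extension
proof
  fix x assume x: "x \<in> insert p (topspace Y)"
  show "closedin (remote_extension Y F p) {x}"
  proof (cases "x = p")
    case True
    have "insert p (topspace Y) - {p} = topspace Y" using p by auto
    then show ?thesis
      using True openin_remote_extension_of_base[OF openin_topspace]
      unfolding closedin_def topspace_remote_extension by auto
  next
    case False
    then have y: "x \<in> topspace Y" using x by auto
    have "insert p (topspace Y) - {x} = insert p (topspace Y - {x})" using False by auto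
    moreover have "openin Y (topspace Y - {x})"
      using t1 y unfolding t1_space_closedin_singleton closedin_def by simp
    moreover have "F {x} \<subseteq> topspace Y - {x}"
      using remote_family_disjoint[OF nowhere_dense_singleton[OF y]] openin_subset[of Y "F {x}"]
        remote_family_clopen[OF nowhere_dense_singleton[OF y]]
      unfolding clopenin_def by (simp add: subset_Diff_insert)
    ultimately show ?thesis
      using openin_remote_extension_insert[OF _ nowhere_dense_singleton[OF y]] y
      unfolding closedin_def topspace_remote_extension by auto
  qed
qed

lemma clopen_based_remote_extension:
  assumes "clopen_based Y"
  shows "clopen_based (remote_extension Y F p)"
  unfolding clopen_based_def
proof (intro allI impI, elim conjE)
  fix W x assume W: "openin (remote_extension Y F p) W" "x \<in> W"
  show "\<exists>C. clopenin (remote_extension Y F p) C \<and> x \<in> C \<and> C \<subseteq> W"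
  proof (cases "x = p")
    case True
    then obtain S where S: "finite S" "\<forall>D\<in>S. nowhere_dense_in Y D" "topspace Y \<inter> \<Inter>(F ` S) \<subseteq> W"
      using W unfolding openin_remote_extension by auto
    have cl: "clopenin (remote_extension Y F p) (insert p (F D))" if "D \<in> S" for D
      using clopenin_remote_extension_insert that S(2) remote_family_clopen by blast
    \<comment> \<open>Intersecting with the space matters for empty \<open>S\<close>, where the
      intersection alone would be \<open>UNIV\<close>.\<close>
    let ?C = "topspace (remote_extension Y F p) \<inter> \<Inter>((\<lambda>D. insert p (F D)) ` S)"
    have "clopenin (remote_extension Y F p) ?C"
    proof (cases "S = {}")
      case True
      then show ?thesis by (simp add: clopenin_def)
    next
      case False
      have "openin (remote_extension Y F p) (\<Inter>((\<lambda>D. insert p (F D)) ` S))"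
        by (rule openin_Inter) (use S(1) cl False in \<open>auto simp: clopenin_def\<close>)
      moreover have "closedin (remote_extension Y F p) (\<Inter>((\<lambda>D. insert p (F D)) ` S))"
        by (rule closedin_Inter) (use cl False in \<open>auto simp: clopenin_def\<close>)
      ultimately show ?thesis
        unfolding clopenin_def by (intro conjI openin_Int closedin_Int openin_topspace closedin_topspace)
    qed
    moreover have "p \<in> ?C" "?C \<subseteq> W"
      using S(3) W(2) True unfolding topspace_remote_extension by auto
    ultimately show ?thesis using True by blast
  next
    case False
    then have x: "x \<in> topspace Y"
      using W openin_subset[OF W(1)] unfolding topspace_remote_extension by auto
    have N: "nowhere_dense_in Y {x}" by (rule nowhere_dense_singleton[OF x])
    obtain C where C: "clopenin Y C" "x \<in> C" "C \<subseteq> W \<inter> topspace Y"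
      using assms openin_base_of_remote_extension[OF W(1)] x W(2) unfolding clopen_based_def
      by (meson IntI)
    \<comment> \<open>A set clopen in \<open>Y\<close> may have \<open>p\<close> in its closure.
      Subtracting \<open>F {x}\<close> prevents this: the neighbourhood of \<open>x\<close> will be
      \<open>C - F {x}\<close>, the complement of the clopen set \<open>insert p ?E\<close>.\<close>
    let ?E = "(topspace Y - C) \<union> F {x}"
    have "clopenin Y ?E" using C(1) remote_family_clopen[OF N] unfolding clopenin_def
      by (simp add: openin_diff closedin_diff openin_Un closedin_Un)
    then have "clopenin (remote_extension Y F p) (insert p ?E)"
      by (rule clopenin_remote_extension_insert[OF _ N]) simp
    then have "clopenin (remote_extension Y F p) (insert p (topspace Y) - insert p ?E)"
      by (rule clopenin_remote_extension_compl)
    moreover have "insert p (topspace Y) - insert p ?E \<subseteq> W" using C(3) by auto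
    moreover have "x \<in> insert p (topspace Y) - insert p ?E"
      using x False C(2) remote_family_disjoint[OF N] by auto
    ultimately show ?thesis by blast
  qed
qed

text \<open>If \<open>x\<close> is \<open>p\<close> and belongs to \<open>A\<close>, the singleton
  \<open>{p}\<close> serves. Otherwise the part of \<open>A\<close> in the second countable space
  \<open>Y\<close> still has \<open>x\<close> in its closure.\<close>

lemma C2_tight_remote_extension:
  assumes "second_countable Y"
  shows "property_tight prop_C2 (remote_extension Y F p)"
  unfolding property_tight_def
proof (intro allI impI, elim conjE)
  let ?X = "remote_extension Y F p"
  fix x A assume x: "x \<in> topspace ?X" "A \<subseteq> topspace ?X" "x \<in> ?X closure_of A"
  have sub: "prop_C2 ?X B" if "B \<subseteq> topspace Y" for B
  proof -
    have "subtopology ?X B = subtopology Y B"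
      using that subtopology_remote_extension
      subtopology_subtopology[of ?X "topspace Y" B] by (simp add: inf.absorb2)
    then show ?thesis using assms second_countable_subtopology unfolding prop_C2_def by simp
  qed
  show "\<exists>B\<subseteq>A. x \<in> ?X closure_of B \<and> prop_C2 ?X B"
  proof (cases "x = p \<and> p \<in> A")
    case True
    have top: "topspace (subtopology ?X {p}) = {p}" by (simp add: topspace_remote_extension)
    then have "openin (subtopology ?X {p}) {p}" by (metis openin_topspace)
    with top have "discrete_topology {p} = subtopology ?X {p}"
      unfolding discrete_topology_unique by blast
    then have "second_countable (subtopology ?X {p})"
      by (metis countable_empty countable_insert second_countable_discrete_topology)
    then show ?thesis
      using True x(1) closure_of_subset[of "{p}" ?X] unfolding prop_C2_def
      by (intro exI[of _ "{p}"]) auto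
  next
    case False
    have "x \<in> ?X closure_of (A \<inter> topspace Y)"
    proof (cases "x = p")
      case True
      then have "A \<inter> topspace Y = A" using False x(2) topspace_remote_extension by auto
      then show ?thesis using x(3) by simp
    next
      case xp: False
      \<comment> \<open>As \<open>{p}\<close> is closed, discarding \<open>p\<close> from
        \<open>A\<close> loses no other point of the closure.\<close>
      have "A \<subseteq> {p} \<union> (A \<inter> topspace Y)" using x(2) topspace_remote_extension by auto
      from subsetD[OF closure_of_mono[OF this] x(3)] have "x \<in> ?X closure_of {p} \<union> ?X closure_of (A \<inter> topspace Y)"
        unfolding closure_of_Un .
      moreover have "?X closure_of {p} = {p}"
        using t1_remote_extension
        by (simp add: closure_of_eq t1_space_closedin_singleton topspace_remote_extension)
      ultimately show ?thesis using xp by auto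
    qed
    then show ?thesis using sub[of "A \<inter> topspace Y"] by (intro exI[of _ "A \<inter> topspace Y"]) auto
  qed
qed

text \<open>\<open>Y\<close> is an open subspace, so the interior in \<open>Y\<close> of the closure
  in \<open>Y\<close> is open in the extension and lies in the larger closure.\<close>

lemma nowhere_dense_in_base:
  assumes "nowhere_dense_in (remote_extension Y F p) B" "B \<subseteq> topspace Y"
  shows "nowhere_dense_in Y B"
proof -
  let ?X = "remote_extension Y F p"
  have "Y closure_of B = topspace Y \<inter> ?X closure_of B"
    using closure_of_subtopology_subset[of ?X "topspace Y" B]
      closure_of_subtopology[of ?X "topspace Y" B] assms(2)
    unfolding subtopology_remote_extension by (simp add: inf.absorb2)
  moreover have "openin ?X (Y interior_of (Y closure_of B))"
    by (intro openin_remote_extension_of_base openin_interior_of)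
  ultimately have "Y interior_of (Y closure_of B) \<subseteq> ?X interior_of (?X closure_of B)"
    by (metis inf.boundedE interior_of_maximal interior_of_subset)
  then show ?thesis using assms(1) unfolding nowhere_dense_in_def by blast
qed

text \<open>Tightness fails at \<open>p\<close> for the set \<open>Y\<close>: a nowhere dense
  \<open>B\<close> inside \<open>Y\<close> is missed by the neighbourhood
  \<open>insert p (F B)\<close>.\<close>

lemma not_omega_N_tight_remote_extension:
  "\<not> property_tight prop_omega_N (remote_extension Y F p)"
proof
  let ?X = "remote_extension Y F p"
  assume "property_tight prop_omega_N ?X"
  moreover have "p \<in> ?X closure_of topspace Y"
    unfolding in_closure_of topspace_remote_extension using remote_nbhd_meets_base by fast
  ultimately obtain B where B: "B \<subseteq> topspace Y" "p \<in> ?X closure_of B" "nowhere_dense_in ?X B"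
    unfolding property_tight_def prop_omega_N_def
    unfolding topspace_remote_extension by (meson insertI1 subset_insertI)
  have N: "nowhere_dense_in Y B" using B(3,1) by (rule nowhere_dense_in_base)
  have "openin ?X (insert p (F B))"
    using openin_remote_extension_insert[OF _ N] remote_family_clopen[OF N] unfolding clopenin_def by simp
  then show False
    using B(1,2) remote_family_disjoint[OF N] p unfolding in_closure_of by blast
qed

end

end

text \<open>A nonempty interior of the closure would contain some \<open>b\<close> in
  \<open>B\<close>. If the open set \<open>V\<close> isolates \<open>b\<close> in \<open>B\<close>,
  then \<open>V\<close> meets that interior within the closure of \<open>{b}\<close>, so
  \<open>b\<close> would be isolated in the whole space.\<close>

lemma discrete_imp_nowhere_dense:
  assumes "crowded_space X" "t1_space X" "subtopology X B = discrete_topology B"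
  shows "nowhere_dense_in X B"
proof (rule ccontr)
  let ?W = "X interior_of (X closure_of B)"
  assume "\<not> nowhere_dense_in X B"
  then have "?W \<noteq> {}" unfolding nowhere_dense_in_def .
  then obtain b where b: "b \<in> ?W" "b \<in> B"
    using interior_of_subset[of X "X closure_of B"] openin_interior_of[of X "X closure_of B"]
    by (meson all_not_in_conv in_closure_of subsetD)
  have bX: "b \<in> topspace X" using b(1) interior_of_subset_topspace[of X] by auto
  have "openin (subtopology X B) {b}" using assms(3) b(2) by simp
  then obtain V where V: "openin X V" "V \<inter> B = {b}" unfolding openin_subtopology by blast
  have op: "openin X (?W \<inter> V)" using V(1) by (simp add: openin_Int)
  have "?W \<inter> V \<subseteq> X closure_of (V \<inter> B)"
    using openin_Int_closure_of_subset[OF V(1), of B] interior_of_subset[of X "X closure_of B"] by blast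
  also have "\<dots> = {b}"
    using V(2) assms(2) bX by (simp add: closure_of_eq t1_space_closedin_singleton)
  finally have "?W \<inter> V = {b}" using b V(2) by blast
  then show False using op assms(1) bX unfolding crowded_space_def by auto
qed

lemma property_tight_mono:
  assumes "property_tight P X" "\<And>B. P X B \<Longrightarrow> Q X B"
  shows "property_tight Q X"
  using assms unfolding property_tight_def by meson

section \<open>The Cantor set without a point\<close>

text \<open>Points of the Cantor set are coded as sets of natural numbers, the removed point being the
  empty set. The clopen pieces consist of the sets with a given least element.\<close>

definition cylinder :: "real set \<Rightarrow> nat \<Rightarrow> real set set" where
  "cylinder s n = {C. C \<subseteq> \<nat> \<and> C \<noteq> {} \<and> C \<inter> {..<real n} = s}"

lemma mem_cylinder: "C \<in> cylinder (C \<inter> {..<real n}) n \<longleftrightarrow> C \<subseteq> \<nat> \<and> C \<noteq> {}"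
  unfolding cylinder_def by auto

lemma cylinder_mono:
  assumes "m \<le> n"
  shows "cylinder (C \<inter> {..<real n}) n \<subseteq> cylinder (C \<inter> {..<real m}) m"
proof
  fix E assume E: "E \<in> cylinder (C \<inter> {..<real n}) n"
  have "E \<inter> {..<real m} = (E \<inter> {..<real n}) \<inter> {..<real m}" using assms by auto
  also have "\<dots> = (C \<inter> {..<real n}) \<inter> {..<real m}" using E unfolding cylinder_def by simp
  also have "\<dots> = C \<inter> {..<real m}" using assms by auto
  finally show "E \<in> cylinder (C \<inter> {..<real m}) m" using E unfolding cylinder_def by simp
qed

text \<open>The topology that the nonempty sets inherit from the product 2^\<nat>. The naturals are
  taken inside the reals so that points have type \<open>real set\<close>.\<close>

definition punctured_cantor :: "real set topology" where
  "punctured_cantor = topology (\<lambda>W. W \<subseteq> Pow \<nat> - {{}} \<and>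
     (\<forall>C\<in>W. \<exists>n. cylinder (C \<inter> {..<real n}) n \<subseteq> W))"

lemma openin_punctured_cantor:
  "openin punctured_cantor W \<longleftrightarrow> W \<subseteq> Pow \<nat> - {{}} \<and>
     (\<forall>C\<in>W. \<exists>n. cylinder (C \<inter> {..<real n}) n \<subseteq> W)"
  (is "_ = ?L W")
proof -
  have inter: "?L (V \<inter> W)" if V: "?L V" and W: "?L W" for V W
  proof -
    have "\<exists>n. cylinder (C \<inter> {..<real n}) n \<subseteq> V \<inter> W" if C: "C \<in> V \<inter> W" for C
    proof -
      obtain m n where "cylinder (C \<inter> {..<real m}) m \<subseteq> V" "cylinder (C \<inter> {..<real n}) n \<subseteq> W"
        using V W C by (meson IntD1 IntD2)
      then have "cylinder (C \<inter> {..<real (max m n)}) (max m n) \<subseteq> V \<inter> W"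
        using cylinder_mono[of m "max m n" C] cylinder_mono[of n "max m n" C] by auto
      then show ?thesis by blast
    qed
    then show ?thesis using V by auto
  qed
  have union: "?L (\<Union>\<K>)" if K: "\<forall>K\<in>\<K>. ?L K" for \<K>
  proof (intro conjI ballI)
    show "\<Union>\<K> \<subseteq> Pow \<nat> - {{}}" using K by auto
    fix C assume "C \<in> \<Union>\<K>"
    then obtain K where "K \<in> \<K>" "C \<in> K" by auto
    moreover then obtain n where "cylinder (C \<inter> {..<real n}) n \<subseteq> K" using K by meson
    ultimately show "\<exists>n. cylinder (C \<inter> {..<real n}) n \<subseteq> \<Union>\<K>" by (meson Union_upper order_trans)
  qed
  have "istopology ?L"
    unfolding istopology_def
    by (rule conjI; intro allI impI) (erule (1) inter, erule union)
  then show ?thesis unfolding punctured_cantor_def by simp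
qed

lemma topspace_punctured_cantor: "topspace punctured_cantor = Pow \<nat> - {{}}"
proof (rule antisym)
  show "topspace punctured_cantor \<subseteq> Pow \<nat> - {{}}"
    using openin_topspace[of punctured_cantor] unfolding openin_punctured_cantor by simp
  have "openin punctured_cantor (Pow \<nat> - {{}})"
    unfolding openin_punctured_cantor cylinder_def by auto
  then show "Pow \<nat> - {{}} \<subseteq> topspace punctured_cantor" by (rule openin_subset)
qed

text \<open>Belonging to the cylinder depends only on the trace below \<open>n\<close>, so the same
  \<open>n\<close> works for the cylinder and for its complement.\<close>

lemma clopenin_cylinder: "clopenin punctured_cantor (cylinder s n)"
proof -
  have "openin punctured_cantor (cylinder s n)"
    unfolding openin_punctured_cantor
    by (intro conjI ballI exI[of _ n]) (auto simp: cylinder_def)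
  moreover have "openin punctured_cantor (topspace punctured_cantor - cylinder s n)"
    unfolding openin_punctured_cantor topspace_punctured_cantor
    by (intro conjI ballI exI[of _ n]) (auto simp: cylinder_def)
  moreover have "cylinder s n \<subseteq> topspace punctured_cantor"
    unfolding topspace_punctured_cantor cylinder_def by auto
  ultimately show ?thesis unfolding clopenin_def closedin_def by simp
qed

lemma cylinder_nbhd:
  assumes "openin punctured_cantor W" "C \<in> W"
  obtains n where "C \<in> cylinder (C \<inter> {..<real n}) n" "cylinder (C \<inter> {..<real n}) n \<subseteq> W"
proof -
  have "C \<subseteq> \<nat>" "C \<noteq> {}" using assms unfolding openin_punctured_cantor by auto
  then have "C \<in> cylinder (C \<inter> {..<real n}) n" for n by (simp add: mem_cylinder)
  moreover obtain n where "cylinder (C \<inter> {..<real n}) n \<subseteq> W"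
    using assms unfolding openin_punctured_cantor by auto
  ultimately show thesis using that by simp
qed

lemma clopen_based_punctured_cantor: "clopen_based punctured_cantor"
  unfolding clopen_based_def by (metis cylinder_nbhd clopenin_cylinder)

lemma finite_Nats_below: "finite (\<nat> \<inter> {..<real n})"
proof (rule finite_subset)
  show "\<nat> \<inter> {..<real n} \<subseteq> real ` {..<n}" by (auto elim!: Nats_cases)
qed simp

text \<open>Traces of points below \<open>n\<close> are finite, and there are only countably many
  pairs of a finite set of naturals and a length.\<close>

lemma second_countable_punctured_cantor: "second_countable punctured_cantor"
proof -
  let ?\<B> = "(\<lambda>(s, n). cylinder s n) ` ({s. finite s \<and> s \<subseteq> \<nat>} \<times> UNIV)"
  have "countable (\<nat> :: real set)" unfolding Nats_def by simp
  then have "countable {s :: real set. finite s \<and> s \<subseteq> \<nat>}"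
    by (simp add: countable_Collect_finite_subset conj_commute)
  then have "countable ?\<B>" by (intro countable_image countable_SIGMA) auto
  moreover have "\<forall>V\<in>?\<B>. openin punctured_cantor V"
    using clopenin_cylinder unfolding clopenin_def by auto
  moreover have "\<exists>V\<in>?\<B>. C \<in> V \<and> V \<subseteq> W" if W: "openin punctured_cantor W" "C \<in> W" for W C
  proof -
    obtain n where n: "C \<in> cylinder (C \<inter> {..<real n}) n" "cylinder (C \<inter> {..<real n}) n \<subseteq> W"
      using W by (rule cylinder_nbhd)
    have "C \<subseteq> \<nat>" using W unfolding openin_punctured_cantor by auto
    then have "finite (C \<inter> {..<real n})" "C \<inter> {..<real n} \<subseteq> \<nat>"
      using finite_subset[OF Int_mono[OF _ order_refl] finite_Nats_below[of n]] by auto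
    then have "cylinder (C \<inter> {..<real n}) n \<in> ?\<B>" by auto
    with n show ?thesis by (intro bexI[of _ "cylinder (C \<inter> {..<real n}) n"]) auto
  qed
  ultimately show ?thesis unfolding second_countable_def by meson
qed

lemma crowded_punctured_cantor: "crowded_space punctured_cantor"
  unfolding crowded_space_def
proof (intro ballI notI)
  fix C assume C: "C \<in> topspace punctured_cantor" "openin punctured_cantor {C}"
  then obtain n where n: "cylinder (C \<inter> {..<real n}) n \<subseteq> {C}"
    using cylinder_nbhd[of "{C}" C] by blast
  \<comment> \<open>Toggling \<open>n\<close> must not produce the removed point, hence the case distinction.\<close>
  define E where "E = (if C = {real n} then {real n, real (Suc n)} else sym_diff C {real n})"
  have "E \<subseteq> \<nat>" "E \<noteq> {}" "E \<inter> {..<real n} = C \<inter> {..<real n}" "E \<noteq> C"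
    using C(1) unfolding topspace_punctured_cantor E_def by (auto split: if_splits)
  then show False using n mem_cylinder[of E n] by auto
qed

lemma t1_punctured_cantor: "t1_space punctured_cantor"
  unfolding t1_space_def
proof (intro ballI impI)
  fix C E
  assume CE: "C \<in> topspace punctured_cantor" "E \<in> topspace punctured_cantor" "C \<noteq> E"
  then have sub: "C \<subseteq> \<nat>" "E \<subseteq> \<nat>" "C \<noteq> {}" unfolding topspace_punctured_cantor by auto
  then obtain m where m: "(real m \<in> C) \<noteq> (real m \<in> E)"
    using CE(3) by (metis Nats_cases subsetD subsetI subset_antisym)
  \<comment> \<open>Length \<open>Suc m\<close> is the first at which the cylinder sees the
    distinguishing element \<open>m\<close>.\<close>
  have "real m \<in> {..<real (Suc m)}" by simp
  then have "E \<notin> cylinder (C \<inter> {..<real (Suc m)}) (Suc m)"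
    using m unfolding cylinder_def by blast
  moreover have "C \<in> cylinder (C \<inter> {..<real (Suc m)}) (Suc m)"
    unfolding mem_cylinder using sub by simp
  ultimately show "\<exists>U. openin punctured_cantor U \<and> C \<in> U \<and> E \<notin> U"
    using clopenin_cylinder unfolding clopenin_def
    by (intro exI[of _ "cylinder (C \<inter> {..<real (Suc m)}) (Suc m)"]) simp
qed

text \<open>This reduces disjointness and covering of the clopen pieces to uniqueness and existence
  of least elements.\<close>

lemma cylinder_least_element:
  "C \<in> cylinder {real n} (Suc n) \<longleftrightarrow>
     C \<subseteq> \<nat> \<and> real n \<in> C \<and> (\<forall>m<n. real m \<notin> C)"
proof (cases "C \<subseteq> \<nat>")
  case True
  have "C \<inter> {..<real (Suc n)} = {real n} \<longleftrightarrow> real n \<in> C \<and> (\<forall>m<n. real m \<notin> C)" (is "?l = ?r")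
  proof
    assume l: ?l
    have "real m \<notin> C" if "m < n" for m
    proof
      assume "real m \<in> C"
      with that have "real m \<in> C \<inter> {..<real (Suc n)}" by simp
      then show False using that unfolding l by simp
    qed
    moreover have "real n \<in> C" using l by blast
    ultimately show ?r by simp
  next
    assume r: ?r
    have "x = real n" if x: "x \<in> C" "x < real (Suc n)" for x
    proof -
      obtain m where m: "x = real m" using x(1) True by (auto elim: Nats_cases)
      then have "m \<le> n" using x(2) by simp
      then show ?thesis using r x(1) m by (cases "m = n") auto
    qed
    then show ?l using r by auto
  qed
  then show ?thesis using True unfolding cylinder_def by auto
qed (simp add: cylinder_def)

theorem mainTheorem1:
  shows "\<exists>X :: real set topology.
           crowded_space X \<and> tychonoff_space X \<and>
           property_tight prop_C2 X \<and>
           \<not> property_tight prop_omega_N X \<and>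
           \<not> property_tight prop_omega_D X"
proof -
  let ?Y = punctured_cantor
  define U where "U n = cylinder {real n} (Suc n)" for n
  have U: "C \<in> U n \<longleftrightarrow> C \<subseteq> \<nat> \<and> real n \<in> C \<and> (\<forall>m<n. real m \<notin> C)" for C n
    unfolding U_def by (rule cylinder_least_element)
  have "(\<Union>n. U n) = topspace ?Y"
  proof (rule set_eqI)
    fix C
    have "\<exists>n. C \<in> U n" if C: "C \<subseteq> \<nat>" "C \<noteq> {}"
    proof -
      obtain m where "real m \<in> C" using C by (metis Nats_cases ex_in_conv subsetD)
      then obtain n where "real n \<in> C" "\<forall>m<n. real m \<notin> C"
        using exists_least_iff[of "\<lambda>m. real m \<in> C"] by auto
      then show ?thesis using C U by auto
    qed
    then show "C \<in> (\<Union>n. U n) \<longleftrightarrow> C \<in> topspace ?Y"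
      unfolding topspace_punctured_cantor by (auto simp: U)
  qed
  moreover have "disjoint_family U"
    unfolding disjoint_family_on_def using U by (metis disjoint_iff nat_neq_iff)
  moreover have "U n \<noteq> {}" for n
  proof -
    have "{real n} \<in> U n" by (simp add: U)
    then show ?thesis by auto
  qed
  moreover have "openin ?Y (U n)" for n
    using clopenin_cylinder unfolding U_def clopenin_def by blast
  ultimately obtain F where F: "remote_family ?Y F"
    using exists_remote_family[OF second_countable_punctured_cantor clopen_based_punctured_cantor, of U]
    by metis
  \<comment> \<open>The empty set, removed as a point of the Cantor set, is free to name the new
    point; its neighbourhoods now come from \<open>F\<close>.\<close>
  let ?X = "remote_extension ?Y F {}"
  have p: "{} \<notin> topspace ?Y" by (simp add: topspace_punctured_cantor)
  note hyps = p F crowded_punctured_cantor t1_punctured_cantor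
  have crowded: "crowded_space ?X" using hyps by (rule crowded_remote_extension)
  have t1: "t1_space ?X" using hyps by (rule t1_remote_extension)
  have not_N: "\<not> property_tight prop_omega_N ?X" using hyps by (rule not_omega_N_tight_remote_extension)
  \<comment> \<open>In this crowded T1 space discrete sets are nowhere dense, so the failure carries
    over from \<omega>N to \<omega>D.\<close>
  moreover have "\<not> property_tight prop_omega_D ?X"
    using not_N property_tight_mono[of prop_omega_D ?X prop_omega_N]
      discrete_imp_nowhere_dense[OF crowded t1] unfolding prop_omega_D_def prop_omega_N_def by blast
  moreover have "tychonoff_space ?X"
    unfolding tychonoff_space_def
    using clopen_based_imp_completely_regular clopen_based_remote_extension[OF hyps]
      clopen_based_punctured_cantor t1 by blast
  moreover have "property_tight prop_C2 ?X"
    using hyps second_countable_punctured_cantor by (rule C2_tight_remote_extension)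
  ultimately show ?thesis using crowded by blast
qed

end
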